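(* Let $M_n$ be the meta-chain hexagonal graph of order $n$. Then: (i) for every $n\geq 2$ and $k\geq 1$, if $n=2k$, then $$ABC_{GG}(M_n)=8\left(\sum_{i=1}^{k}\sqrt{\frac{10k-1}{(10k-5i+3)(5i-2)}}\right)+4k\sqrt{\frac{10k-1}{30k-6}},$$ and if $n=2k+1$, then $$ABC_{GG}(M_n)=8\left(\sum_{i=1}^{k}\sqrt{\frac{10k+4}{(10k-5i+8)(5i-2)}}\right)+(4k+2)\sqrt{\frac{10k+4}{30k+9}}+\frac{4\sqrt{10k+4}}{5k+3};$$ (ii) for every $n\geq 2$, $ABC(M_n)=3n\sqrt{2}$.
   Context: For a finite simple graph $G$, $ABC(G)=\sum_{uv\in E(G)}\sqrt{\frac{d_u+d_v-2}{d_ud_v}}$, where $d_u$ is the degree of $u$ in $G$. For an edge $uv$ of $G$, $n_u(uv,G)$ is the number of vertices of $G$ strictly closer to $u$ than to $v$, and $n_v(uv,G)$ is defined analogously; equidistant vertices are not counted. $ABC_{GG}(G)=\sum_{uv\in E(G)}\sqrt{\frac{n_u(uv,G)+n_v(uv,G)-2}{n_u(uv,G)n_v(uv,G)}}$. The meta-chain hexagonal graph $M_n$ of order $n$ consists of $n$ hexagons glued in a chain with contact vertices at distance 2: take $n$ disjoint 6-cycles, choose in the $i$-th one two vertices $x_i,y_i$ at distance 2, and identify $y_i$ with $x_{i+1}$ for $i=1,\ldots,n-1$. *)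

theory Defs
  imports Complex_Main "HOL-Library.Extended_Nat"
begin

record 'a graph =
  verts :: "'a set"
  edges :: "'a set set"

definition simple_graph :: "'a graph \<Rightarrow> bool" where
  "simple_graph G \<longleftrightarrow> finite (verts G) \<and>
     (\<forall>e\<in>edges G. e \<subseteq> verts G \<and> card e = 2)"

definition degree :: "'a graph \<Rightarrow> 'a \<Rightarrow> nat" where
  "degree G u = card {v \<in> verts G. {u, v} \<in> edges G}"

definition adj_rel :: "'a graph \<Rightarrow> 'a rel" where
  "adj_rel G = {(u, v). {u, v} \<in> edges G}"

text \<open>The pair \<open>(u, v)\<close> is in the \<open>k\<close>-th relational power of adjacency iff there is a walk of
  length \<open>k\<close> from \<open>u\<close> to \<open>v\<close>; the infimum is \<open>\<infinity>\<close> if there is no walk at all.\<close>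

definition gdist :: "'a graph \<Rightarrow> 'a \<Rightarrow> 'a \<Rightarrow> enat" where
  "gdist G u v = (INF k\<in>{k. (u, v) \<in> adj_rel G ^^ k}. enat k)"

definition n_closer :: "'a graph \<Rightarrow> 'a \<Rightarrow> 'a \<Rightarrow> nat" where
  "n_closer G u v = card {w \<in> verts G. gdist G w u < gdist G w v}"

text \<open>Sum of \<open>f u v\<close> over the unordered edges \<open>uv\<close>, each counted once. Only meaningful for \<open>f\<close>
  symmetric in its two arguments, when the description does not depend on the order of the
  endpoints.\<close>

definition edge_sum :: "'a graph \<Rightarrow> ('a \<Rightarrow> 'a \<Rightarrow> real) \<Rightarrow> real" where
  "edge_sum G f = (\<Sum>e\<in>edges G. THE r. \<exists>u v. e = {u, v} \<and> r = f u v)"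

definition ABC :: "'a graph \<Rightarrow> real" where
  "ABC G = edge_sum G (\<lambda>u v.
     sqrt ((real (degree G u) + real (degree G v) - 2) /
           (real (degree G u) * real (degree G v))))"

definition ABC_GG :: "'a graph \<Rightarrow> real" where
  "ABC_GG G = edge_sum G (\<lambda>u v.
     sqrt ((real (n_closer G u v) + real (n_closer G v u) - 2) /
           (real (n_closer G u v) * real (n_closer G v u))))"

definition hexagon :: "nat graph" where
  "hexagon = \<lparr>verts = {..<6}, edges = {{a, Suc a mod 6} | a. a < 6}\<rparr>"

text \<open>The vertex \<open>a\<close> of the \<open>i\<close>-th of \<open>n\<close> disjoint hexagons is \<open>(i, a)\<close>, with \<open>i\<close> in \<open>{1..n}\<close>.
  Vertices of the glued graph are the classes of the equivalence relation generated by
  identifying the vertex \<open>y i\<close> of hexagon \<open>i\<close> with the vertex \<open>x (i + 1)\<close> of hexagon \<open>i + 1\<close>.\<close>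

definition glue_rel :: "nat \<Rightarrow> (nat \<Rightarrow> nat) \<Rightarrow> (nat \<Rightarrow> nat) \<Rightarrow> (nat \<times> nat) rel" where
  "glue_rel n x y = {((i, y i), (Suc i, x (Suc i))) | i. 1 \<le> i \<and> i < n}"

definition glue_class ::
    "nat \<Rightarrow> (nat \<Rightarrow> nat) \<Rightarrow> (nat \<Rightarrow> nat) \<Rightarrow> nat \<times> nat \<Rightarrow> (nat \<times> nat) set" where
  "glue_class n x y p = (glue_rel n x y \<union> (glue_rel n x y)\<inverse>)\<^sup>* `` {p}"

definition hexagon_chain ::
    "nat \<Rightarrow> (nat \<Rightarrow> nat) \<Rightarrow> (nat \<Rightarrow> nat) \<Rightarrow> (nat \<times> nat) set graph" where
  "hexagon_chain n x y =
     \<lparr>verts = {glue_class n x y (i, a) | i a. i \<in> {1..n} \<and> a \<in> verts hexagon},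
      edges = {(\<lambda>a. glue_class n x y (i, a)) ` e | i e. i \<in> {1..n} \<and> e \<in> edges hexagon}\<rparr>"

text \<open>The contact vertices \<open>x i\<close>, \<open>y i\<close> are arbitrary apart from being at distance 2, so that the
  predicate covers every realisation of the meta-chain. The choices \<open>x 1\<close> and \<open>y n\<close> have no
  effect on the graph.\<close>

definition is_meta_chain :: "nat \<Rightarrow> (nat \<times> nat) set graph \<Rightarrow> bool" where
  "is_meta_chain n M \<longleftrightarrow>
     (\<exists>x y. (\<forall>i\<in>{1..n}. x i \<in> verts hexagon \<and> y i \<in> verts hexagon \<and>
               gdist hexagon (x i) (y i) = 2) \<and>
            M = hexagon_chain n x y)"

lemma gdist_self: "gdist G u u = 0"
proof -
  have "gdist G u u \<le> enat 0"
    unfolding gdist_def by (rule INF_lower) simp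
  then show ?thesis by (simp flip: zero_enat_def)
qed

lemma gdist_hexagon_0_2: "gdist hexagon 0 2 = 2"
proof (rule antisym)
  have "(0, 1) \<in> adj_rel hexagon" "(1, 2) \<in> adj_rel hexagon"
    unfolding adj_rel_def hexagon_def by force+
  then have "(0, 2) \<in> adj_rel hexagon ^^ 2"
    by (auto simp: numeral_2_eq_2)
  then have "gdist hexagon 0 2 \<le> enat 2"
    unfolding gdist_def by (intro INF_lower) simp
  then show "gdist hexagon 0 2 \<le> 2" by (simp add: numeral_eq_enat)
next
  have nadj: "(0, 2) \<notin> adj_rel hexagon"
    unfolding adj_rel_def hexagon_def
    by (auto simp: doubleton_eq_iff)
  have "2 \<le> k" if "(0, 2) \<in> adj_rel hexagon ^^ k" for k
  proof (rule ccontr)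
    assume "\<not> 2 \<le> k"
    then have "k = 0 \<or> k = 1" by auto
    with that nadj show False by auto
  qed
  then have "enat 2 \<le> gdist hexagon 0 2"
    unfolding gdist_def by (intro INF_greatest) simp
  then show "2 \<le> gdist hexagon 0 2" by (simp add: numeral_eq_enat)
qed

lemma meta_chain_exists: "\<exists>M. is_meta_chain n M"
proof -
  have "is_meta_chain n (hexagon_chain n (\<lambda>_. 0) (\<lambda>_. 2))"
    unfolding is_meta_chain_def
    by (rule exI[of _ "\<lambda>_. 0"], rule exI[of _ "\<lambda>_. 2"], simp add: gdist_hexagon_0_2)
       (simp add: hexagon_def)
  then show ?thesis by blast
qed

lemma glue_class_inj:
  assumes neq: "\<And>i. i \<in> {1..n} \<Longrightarrow> x i \<noteq> y i"
    and eq: "glue_class n x y (i, a) = glue_class n x y (i, b)"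
  shows "a = b"
proof -
  let ?R = "glue_rel n x y"
  have closure: "p = q \<or> (p, q) \<in> ?R \<or> (q, p) \<in> ?R"
    if "(p, q) \<in> (?R \<union> ?R\<inverse>)\<^sup>*" for p q
    using that
  proof (induction rule: rtrancl_induct)
    case base
    show ?case by simp
  next
    case (step q r)
    have no_chain: False if "(u, v) \<in> ?R" "(v, w) \<in> ?R" for u v w
      using that neq[of "fst v"] by (auto simp: glue_rel_def)
    have "u = w" if "(u, v) \<in> ?R" "(w, v) \<in> ?R" for u v w
      using that by (auto simp: glue_rel_def)
    moreover have "u = w" if "(v, u) \<in> ?R" "(v, w) \<in> ?R" for u v w
      using that by (auto simp: glue_rel_def)
    ultimately show ?case using step no_chain by blast
  qed
  have "(i, b) \<in> glue_class n x y (i, a)"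
    unfolding eq by (simp add: glue_class_def)
  then have "((i, a), (i, b)) \<in> (?R \<union> ?R\<inverse>)\<^sup>*"
    by (simp add: glue_class_def)
  from closure[OF this] show ?thesis by (auto simp: glue_rel_def)
qed

lemma meta_chain_simple:
  assumes "is_meta_chain n M"
  shows "simple_graph M"
proof -
  obtain x y where xy: "\<And>i. i \<in> {1..n} \<Longrightarrow> gdist hexagon (x i) (y i) = 2"
    and M: "M = hexagon_chain n x y"
    using assms unfolding is_meta_chain_def by blast
  have neq: "x i \<noteq> y i" if "i \<in> {1..n}" for i
    using xy[OF that] gdist_self[of hexagon "x i"] by auto
  have "verts M = (\<lambda>(i, a). glue_class n x y (i, a)) ` ({1..n} \<times> {..<6})"
    unfolding M hexagon_chain_def hexagon_def by (force simp: image_iff)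
  then have fin: "finite (verts M)" by simp
  have hex: "e \<subseteq> verts hexagon \<and> card e = 2" if e: "e \<in> edges hexagon" for e
  proof -
    obtain a where a: "a < 6" "e = {a, Suc a mod 6}"
      using e unfolding hexagon_def graph.select_convs by blast
    have "a \<noteq> Suc a mod 6" using a(1) by presburger
    then show ?thesis using a by (simp add: hexagon_def)
  qed
  have "e \<subseteq> verts M \<and> card e = 2" if e: "e \<in> edges M" for e
  proof -
    obtain i h where ih: "i \<in> {1..n}" "h \<in> edges hexagon"
        "e = (\<lambda>a. glue_class n x y (i, a)) ` h"
      using e unfolding M hexagon_chain_def by auto
    have "inj_on (\<lambda>a. glue_class n x y (i, a)) h"
      by (rule inj_onI) (use glue_class_inj[of n x y i] neq in blast)
    then have "card e = 2" using ih hex by (simp add: card_image)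
    moreover have "e \<subseteq> verts M"
      using ih hex[OF ih(2)] unfolding M hexagon_chain_def by auto
    ultimately show ?thesis by blast
  qed
  with fin show ?thesis by (simp add: simple_graph_def)
qed

end

theory Submission
  imports Defs
begin

text \<open>The proof of the formula for \<open>ABC_GG\<close> never computes a distance. In each hexagon of the
  chain, the edge \<open>{a, a + 1}\<close> and its opposite edge \<open>{a + 3, a + 4}\<close> form a cut: removing both
  separates the whole chain into two sides. Reflecting one half of this hexagon onto the other,
  and collapsing every part of the chain that hangs on the reflected half to a single vertex,
  gives a map of the chain onto one side that sends edges to edges or to vertices, fixes
  that side, and collapses the two cut edges. Such a folding map turns a walk from the side to the
  far end of a cut edge into a strictly shorter walk to the near end (\<open>fold_closer\<close>). Hence the
  vertices closer to an end of a cut edge are exactly those on its side of the cut, and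
  \<open>n_closer\<close> is a cardinality that can be counted (\<open>n_closer_fold\<close>, \<open>n_closer_edge\<close>).

  The first \<open>i - 1\<close> hexagons contribute \<open>5 (i - 1)\<close> vertices outside hexagon \<open>i\<close>, attached at
  \<open>x i\<close>, and the last \<open>n - i\<close> contribute \<open>5 (n - i)\<close>, attached at \<open>y i\<close>. As the contact
  vertices have distance 2, two of the three cuts of hexagon \<open>i\<close> separate them, with sides of
  \<open>5 i - 2\<close> and \<open>5 n - 5 i + 3\<close> vertices, and the third does not, with sides of \<open>3\<close> and
  \<open>5 n - 2\<close> vertices. Each cut has two edges, so the hexagon contributes four terms of the first
  kind and two of the second. The symmetry \<open>i \<mapsto> n + 1 - i\<close> then pairs the terms of the sum
  over all hexagons and leaves a middle term exactly when \<open>n\<close> is odd (\<open>sum_symmetric\<close>).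

  For \<open>ABC\<close>, contact vertices are never adjacent, so every edge has an end of degree 2. Then
  the term of the edge is \<open>sqrt (d / (2 d)) = sqrt 2 / 2\<close>, whatever the degree \<open>d\<close> of the other
  end, and there are \<open>6 n\<close> edges.\<close>

section \<open>Distances and folding maps\<close>

lemma gdist_attained:
  assumes "gdist G u v = enat k"
  shows "(u, v) \<in> adj_rel G ^^ k"
proof -
  let ?A = "enat ` {k. (u, v) \<in> adj_rel G ^^ k}"
  have "?A \<noteq> {}"
  proof
    assume "?A = {}"
    then have "gdist G u v = \<infinity>" by (simp add: gdist_def Inf_enat_def)
    then show False using assms by simp
  qed
  then have "Inf ?A \<in> ?A"
    by (metis (mono_tags, lifting) Inf_enat_def LeastI_ex ex_in_conv)
  then show ?thesis using assms by (auto simp: gdist_def)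
qed

lemma gdist_le_walk:
  assumes "(u, v) \<in> adj_rel G ^^ k"
  shows "gdist G u v \<le> enat k"
  unfolding gdist_def by (rule INF_lower) (use assms in simp)

text \<open>The picture is a sheet folded along the edges that leave \<open>S\<close>: these are collapsed and no edge is
  torn. Other edges may be collapsed as well, so that a whole part of the graph outside \<open>S\<close> can
  be sent to a single vertex.\<close>

definition folds_onto :: "'a graph \<Rightarrow> 'a set \<Rightarrow> ('a \<Rightarrow> 'a) \<Rightarrow> bool" where
  "folds_onto G S \<phi> \<longleftrightarrow>
     (\<forall>w\<in>S. \<phi> w = w) \<and>
     (\<forall>s t. {s, t} \<in> edges G \<longrightarrow>
        \<phi> s = \<phi> t \<or> {\<phi> s, \<phi> t} \<in> edges G \<and> (s \<in> S \<longleftrightarrow> t \<in> S))"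

text \<open>The image of a walk is a walk in which the collapsed edges are missing; a walk that leaves \<open>S\<close>
  uses at least one of those.\<close>

lemma fold_shortens_walk:
  assumes fold: "folds_onto G S \<phi>" and "(s, t) \<in> adj_rel G ^^ k"
  shows "\<exists>l\<le>k. (\<phi> s, \<phi> t) \<in> adj_rel G ^^ l \<and> (s \<in> S \<and> t \<notin> S \<longrightarrow> l < k)"
  using assms(2)
proof (induction k arbitrary: t)
  case 0
  then show ?case by auto
next
  case (Suc k)
  then obtain r where r: "(s, r) \<in> adj_rel G ^^ k" "{r, t} \<in> edges G"
    by (auto simp: adj_rel_def)
  obtain l where l: "l \<le> k" "(\<phi> s, \<phi> r) \<in> adj_rel G ^^ l" "s \<in> S \<and> r \<notin> S \<longrightarrow> l < k"
    using Suc.IH[OF r(1)] by blast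
  show ?case
  proof (cases "\<phi> r = \<phi> t")
    case True
    then show ?thesis using l by (intro exI[of _ l]) auto
  next
    case False
    then have e: "{\<phi> r, \<phi> t} \<in> edges G" "r \<in> S \<longleftrightarrow> t \<in> S"
      using fold r(2) unfolding folds_onto_def by blast+
    then have "(\<phi> s, \<phi> t) \<in> adj_rel G ^^ Suc l"
      using l(2) by (auto simp: adj_rel_def)
    then show ?thesis using l e(2) by (intro exI[of _ "Suc l"]) auto
  qed
qed

lemma fold_closer:
  assumes fold: "folds_onto G S \<phi>" and conn: "(w, v) \<in> (adj_rel G)\<^sup>*"
    and "w \<in> S" "v \<notin> S" "\<phi> v = u"
  shows "gdist G w u < gdist G w v"
proof -
  obtain m where "(w, v) \<in> adj_rel G ^^ m"
    using conn by (auto simp: rtrancl_power)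
  then obtain k where k: "gdist G w v = enat k"
    using gdist_le_walk enat_ile by metis
  obtain l where "l < k" "(\<phi> w, \<phi> v) \<in> adj_rel G ^^ l"
    using fold_shortens_walk[OF fold gdist_attained[OF k]] assms by blast
  moreover have "\<phi> w = w" using fold \<open>w \<in> S\<close> by (simp add: folds_onto_def)
  ultimately have "gdist G w u \<le> enat l"
    using gdist_le_walk \<open>\<phi> v = u\<close> by metis
  also have "\<dots> < enat k" using \<open>l < k\<close> by simp
  finally show ?thesis by (simp add: k)
qed

text \<open>With a folding map onto each side of a cut, every vertex is strictly closer to the end of
  \<open>uv\<close> on its own side, so there are no ties. The sides \<open>S\<close> and \<open>T\<close> are compared among the
  vertices only, since the sides used for the chain also contain classes of pairs that are no
  vertices.\<close>

lemma n_closer_fold: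
  assumes conn: "\<And>w z. w \<in> verts G \<Longrightarrow> z \<in> verts G \<Longrightarrow> (w, z) \<in> (adj_rel G)\<^sup>*"
    and S: "folds_onto G S \<phi>" "u \<in> S" "u \<in> verts G" "\<phi> v = u"
    and T: "folds_onto G T \<psi>" "v \<in> T" "v \<in> verts G" "\<psi> u = v"
    and compl: "\<And>w. w \<in> verts G \<Longrightarrow> w \<in> T \<longleftrightarrow> w \<notin> S"
  shows "n_closer G u v = card (verts G \<inter> S)"
proof -
  have "gdist G w u < gdist G w v \<longleftrightarrow> w \<in> S" if w: "w \<in> verts G" for w
  proof (cases "w \<in> S")
    case True
    then show ?thesis using fold_closer[OF S(1) conn[OF w T(3)]] S T compl by blast
  next
    case False
    then have "gdist G w v < gdist G w u"
      using fold_closer[OF T(1) conn[OF w S(3)], of v] S T compl w by blast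
    then show ?thesis using False by auto
  qed
  then have "{w \<in> verts G. gdist G w u < gdist G w v} = verts G \<inter> S" by blast
  then show ?thesis by (simp add: n_closer_def)
qed

section \<open>Opposite edges of a hexagon\<close>

text \<open>The edges \<open>{a, a + 1}\<close> and \<open>{a + 3, a + 4}\<close> cut the hexagon into the path \<open>half a\<close>, which contains
  \<open>a + 1\<close>, and the path \<open>half (a + 3)\<close>, which contains \<open>a\<close>.\<close>

definition half :: "nat \<Rightarrow> nat set" where
  "half a = {(a + 1) mod 6, (a + 2) mod 6, (a + 3) mod 6}"

text \<open>The reflection \<open>b \<mapsto> 2 a + 1 - b\<close> modulo 6, which swaps the ends of both cut edges. The summand 7
  replaces 1 to keep the subtraction exact for \<open>b < 6\<close>.\<close>

definition reflect :: "nat \<Rightarrow> nat \<Rightarrow> nat" where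
  "reflect a b = (2 * a + 7 - b) mod 6"

definition fold_hex :: "nat \<Rightarrow> nat \<Rightarrow> nat" where
  "fold_hex a b = (if b \<in> half a then b else reflect a b)"

text \<open>Facts on a single hexagon are checked vertex by vertex with this case distinction.\<close>

lemma less_6_cases: "(a :: nat) < 6 \<longleftrightarrow> a = 0 \<or> a = 1 \<or> a = 2 \<or> a = 3 \<or> a = 4 \<or> a = 5"
  by auto

lemma half_opposite:
  assumes "a < 6" "b < 6"
  shows "b \<in> half ((a + 3) mod 6) \<longleftrightarrow> b \<notin> half a"
  using assms unfolding less_6_cases by (elim disjE; simp add: half_def)

lemma card_half:
  assumes "a < 6"
  shows "card {b. b < 6 \<and> b \<in> half a} = 3"
proof -
  have "{b. b < 6 \<and> b \<in> half a} = half a" by (auto simp: half_def)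
  then show ?thesis
    using assms unfolding less_6_cases by (elim disjE; simp add: half_def)
qed

lemma endpoints_half:
  assumes "a < 6"
  shows "Suc a mod 6 \<in> half a" "a \<notin> half a"
    "fold_hex a a = Suc a mod 6" "fold_hex ((a + 3) mod 6) (Suc a mod 6) = a"
  using assms unfolding less_6_cases
  by (elim disjE; simp add: half_def fold_hex_def reflect_def)+

lemma fold_hex_less: "b < 6 \<Longrightarrow> fold_hex a b < 6"
  by (simp add: fold_hex_def reflect_def)

lemma sum_lessThan_6:
  fixes f :: "nat \<Rightarrow> real"
  shows "(\<Sum>a<6. f a) = f 0 + f 1 + f 2 + f 3 + f 4 + f 5"
  by (simp add: numeral_eq_Suc)

text \<open>Of the three cuts of a hexagon, two separate vertices at distance 2 and one does not. As \<open>a\<close> runs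
  through the hexagon, each cut is met twice, once with each of its halves as \<open>half a\<close>.\<close>

lemma sum_cut_patterns:
  fixes f :: "bool \<Rightarrow> bool \<Rightarrow> real"
  assumes "u < 6" "v = (u + 2) mod 6 \<or> v = (u + 4) mod 6"
  shows "(\<Sum>a<6. f (u \<in> half a) (v \<in> half a)) =
    2 * f True False + 2 * f False True + f True True + f False False"
  unfolding sum_lessThan_6 using assms unfolding less_6_cases
  by (elim disjE; simp add: half_def)

lemma hexagon_edge:
  assumes "b < 6" "d < 6"
  shows "{b, d} \<in> edges hexagon \<longleftrightarrow> d = Suc b mod 6 \<or> b = Suc d mod 6"
  using assms by (auto simp: hexagon_def doubleton_eq_iff)

lemma Suc_mod_6_iff:
  assumes "a < 6" "b < 6"
  shows "b = Suc a mod 6 \<longleftrightarrow> a = (b + 5) mod 6"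
  using assms unfolding less_6_cases by (elim disjE; simp)

lemma Suc_mod_6_asym:
  assumes "a < 6" "b < 6" "a = Suc b mod 6"
  shows "b \<noteq> Suc a mod 6"
  using assms unfolding less_6_cases by (elim disjE; simp)

text \<open>The reflection is a symmetry of the hexagon, so the fold preserves the edges within each half,
  and only the two cut edges are collapsed.\<close>

lemma fold_hex_edge:
  assumes "a < 6" "b < 6"
  shows "fold_hex a b = fold_hex a (Suc b mod 6) \<or>
    {fold_hex a b, fold_hex a (Suc b mod 6)} \<in> edges hexagon \<and>
      (b \<in> half a \<longleftrightarrow> Suc b mod 6 \<in> half a)"
  unfolding hexagon_edge[OF fold_hex_less[OF assms(2)] fold_hex_less[of "Suc b mod 6" a, simplified]]
  using assms unfolding less_6_cases
  by (elim disjE; simp add: half_def fold_hex_def reflect_def)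

text \<open>All that is needed of the distance is that a walk of length 2 exists and that the ends
  differ.\<close>

lemma distance_two_hexagon:
  assumes "u < 6" "v < 6" "gdist hexagon u v = 2"
  shows "v = (u + 2) mod 6 \<or> v = (u + 4) mod 6"
proof -
  have "(u, v) \<in> adj_rel hexagon ^^ 2"
    using assms(3) by (intro gdist_attained) (simp add: numeral_eq_enat)
  then obtain w where w: "{u, w} \<in> edges hexagon" "{w, v} \<in> edges hexagon"
    by (auto simp: numeral_2_eq_2 adj_rel_def)
  have "w < 6" using w(1) by (auto simp: hexagon_def doubleton_eq_iff)
  then have uw: "u = (w + 5) mod 6 \<or> u = Suc w mod 6"
    and wv: "v = Suc w mod 6 \<or> v = (w + 5) mod 6"
    using w assms by (auto simp: hexagon_edge Suc_mod_6_iff)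
  have "u \<noteq> v" using assms(3) by (auto simp: gdist_self)
  then show ?thesis
    using uw wv \<open>w < 6\<close> unfolding less_6_cases by (elim disjE; simp)
qed

section \<open>Vertices and edges of the chain\<close>

locale meta_chain =
  fixes n :: nat and x y :: "nat \<Rightarrow> nat"
  assumes contact: "i \<in> {1..n} \<Longrightarrow>
    x i < 6 \<and> y i < 6 \<and> (y i = (x i + 2) mod 6 \<or> y i = (x i + 4) mod 6)"
begin

abbreviation vertex :: "nat \<Rightarrow> nat \<Rightarrow> (nat \<times> nat) set" where
  "vertex i a \<equiv> glue_class n x y (i, a)"

abbreviation chain :: "(nat \<times> nat) set graph" where
  "chain \<equiv> hexagon_chain n x y"

lemma contact_less: "i \<in> {1..n} \<Longrightarrow> x i < 6" "i \<in> {1..n} \<Longrightarrow> y i < 6"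
  using contact by blast+

lemma contact_neq: "i \<in> {1..n} \<Longrightarrow> x i \<noteq> y i"
proof -
  assume "i \<in> {1..n}"
  from contact[OF this, unfolded less_6_cases] show ?thesis by (elim conjE disjE; simp)
qed

lemma vertex_inj: "vertex i a = vertex i b \<longleftrightarrow> a = b"
  using glue_class_inj[of n x y i a b] contact_neq by blast

lemma glue_rel_same_class: "(p, q) \<in> glue_rel n x y \<Longrightarrow> glue_class n x y p = glue_class n x y q"
proof -
  assume pq: "(p, q) \<in> glue_rel n x y"
  let ?R = "glue_rel n x y \<union> (glue_rel n x y)\<inverse>"
  have "(p, q) \<in> ?R\<^sup>*" "(q, p) \<in> ?R\<^sup>*" using pq by auto
  then show ?thesis unfolding glue_class_def by (auto intro: rtrancl_trans)
qed

lemma contact_vertex: "1 \<le> i \<Longrightarrow> i < n \<Longrightarrow> vertex i (y i) = vertex (Suc i) (x (Suc i))"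
  by (rule glue_rel_same_class) (auto simp: glue_rel_def)

text \<open>Functions on the disjoint union that agree on glued pairs are constant on classes. This serves
  to define maps on the glued graph and, with predicates \<open>F\<close>, sets of classes and to tell
  classes apart.\<close>

lemma same_class_invariant:
  assumes resp: "\<And>i. 1 \<le> i \<Longrightarrow> i < n \<Longrightarrow> F (i, y i) = F (Suc i, x (Suc i))"
    and "glue_class n x y p = glue_class n x y q"
  shows "F p = F q"
proof -
  have "q \<in> glue_class n x y p" unfolding assms(2) by (simp add: glue_class_def)
  then have "(p, q) \<in> (glue_rel n x y \<union> (glue_rel n x y)\<inverse>)\<^sup>*"
    by (simp add: glue_class_def)
  then show ?thesis
    by (induction rule: rtrancl_induct) (use resp in \<open>force simp: glue_rel_def\<close>)+
qed

lemma descends: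
  assumes "\<And>i. 1 \<le> i \<Longrightarrow> i < n \<Longrightarrow> F (i, y i) = F (Suc i, x (Suc i))"
  obtains \<phi> where "\<And>p. \<phi> (glue_class n x y p) = F p"
proof
  fix p
  show "(\<lambda>C. F (SOME q. glue_class n x y q = C)) (glue_class n x y p) = F p"
    by (rule same_class_invariant[OF assms], assumption, assumption)
       (rule someI[of _ p], rule refl)
qed

text \<open>Different hexagons meet only if they are consecutive, and then only in their contact vertex:
  since \<open>x i \<noteq> y i\<close>, a class never reaches over three hexagons.\<close>

lemma same_vertex_later:
  assumes "vertex i a = vertex j b" "i < j"
  shows "j = Suc i \<and> 1 \<le> i \<and> i < n \<and> a = y i \<and> b = x j"
proof (cases "1 \<le> i \<and> i < n \<and> a = y i")
  case True
  then have eq: "vertex (Suc i) (x (Suc i)) = vertex j b"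
    using assms(1) contact_vertex by simp
  show ?thesis
  proof (cases "j = Suc i")
    case True
    then show ?thesis using eq vertex_inj \<open>1 \<le> i \<and> i < n \<and> a = y i\<close> by auto
  next
    case False
    \<comment> \<open>The class of a contact vertex consists of the two pairs glued there.\<close>
    define F where "F p = (p \<in> {(i, y i), (Suc i, x (Suc i))})" for p :: "nat \<times> nat"
    have "F (j, b) = F (Suc i, x (Suc i))"
      by (rule same_class_invariant[OF _ eq[symmetric]])
         (use True contact_neq[of "Suc i"] contact_neq[of i] in \<open>auto simp: F_def\<close>)
    then show ?thesis using False assms(2) by (auto simp: F_def)
  qed
next
  case False
  \<comment> \<open>Here the class of \<open>(i, a)\<close> reaches back to hexagon \<open>i - 1\<close> at most.\<close>
  define F where "F p = (p = (i, a) \<or> 1 < i \<and> i \<le> n \<and> a = x i \<and> p = (i - 1, y (i - 1)))"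
    for p :: "nat \<times> nat"
  have "F (j, b) = F (i, a)"
    by (rule same_class_invariant[OF _ assms(1)[symmetric]])
       (use False contact_neq[of i] contact_neq[of "i-1"] in \<open>auto simp: F_def\<close>)
  then show ?thesis using assms(2) by (auto simp: F_def)
qed

lemma verts_chain: "verts chain = {vertex i a | i a. i \<in> {1..n} \<and> a < 6}"
  by (auto simp: hexagon_chain_def hexagon_def)

lemma vertex_in_chain: "i \<in> {1..n} \<Longrightarrow> a < 6 \<Longrightarrow> vertex i a \<in> verts chain"
  by (auto simp: verts_chain)

lemma finite_verts: "finite (verts chain)"
proof -
  have "verts chain = (\<lambda>(i, a). vertex i a) ` ({1..n} \<times> {..<6})"
    by (fastforce simp: verts_chain)
  then show ?thesis by simp
qed

lemma edge_in_chain: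
  assumes "i \<in> {1..n}" "{a, b} \<in> edges hexagon"
  shows "{vertex i a, vertex i b} \<in> edges chain"
proof -
  have "(\<lambda>a. vertex i a) ` {a, b} \<in> edges chain"
    unfolding hexagon_chain_def graph.select_convs using assms by blast
  then show ?thesis by simp
qed

definition hex_edge :: "nat \<times> nat \<Rightarrow> (nat \<times> nat) set set" where
  "hex_edge = (\<lambda>(i, a). {vertex i a, vertex i (Suc a mod 6)})"

lemma edges_chain: "edges chain = hex_edge ` ({1..n} \<times> {..<6})"
proof
  show "edges chain \<subseteq> hex_edge ` ({1..n} \<times> {..<6})"
  proof
    fix e assume "e \<in> edges chain"
    then obtain i a where "i \<in> {1..n}" "a < 6" "e = (\<lambda>a. vertex i a) ` {a, Suc a mod 6}"
      unfolding hexagon_chain_def hexagon_def graph.select_convs by blast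
    then have "e = hex_edge (i, a)" "(i, a) \<in> {1..n} \<times> {..<6}" by (auto simp: hex_edge_def)
    then show "e \<in> hex_edge ` ({1..n} \<times> {..<6})" by blast
  qed
  show "hex_edge ` ({1..n} \<times> {..<6}) \<subseteq> edges chain"
    unfolding hex_edge_def by (auto simp: hexagon_edge intro: edge_in_chain)
qed

lemma edge_chain_cases:
  assumes "{s, t} \<in> edges chain"
  obtains i a where "i \<in> {1..n}" "a < 6"
    "s = vertex i a \<and> t = vertex i (Suc a mod 6) \<or> t = vertex i a \<and> s = vertex i (Suc a mod 6)"
  using assms by (auto simp: edges_chain hex_edge_def doubleton_eq_iff)

text \<open>Two hexagons share at most one vertex, hence no edge. So the sum over the edges of the chain
  splits into sums over the hexagons.\<close>

lemma hex_edge_inj: "inj_on hex_edge ({1..n} \<times> {..<6})"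
proof -
  have no: False
    if "hex_edge (i, a) = hex_edge (j, b)" "i < j" "a < 6" for i a j b
  proof -
    have "vertex i a = vertex j b \<or> vertex i a = vertex j (Suc b mod 6)"
      "vertex i (Suc a mod 6) = vertex j b \<or> vertex i (Suc a mod 6) = vertex j (Suc b mod 6)"
      using that(1) by (auto simp: hex_edge_def doubleton_eq_iff)
    then have "a = Suc a mod 6"
      using same_vertex_later[OF _ \<open>i < j\<close>] by metis
    then show False using Suc_mod_6_asym[OF \<open>a < 6\<close> \<open>a < 6\<close>] by blast
  qed
  have same: "a = b" if "hex_edge (i, a) = hex_edge (i, b)" "a < 6" "b < 6" for i a b
  proof -
    have "a = b \<or> a = Suc b mod 6 \<and> b = Suc a mod 6"
      using that(1) by (auto simp: hex_edge_def doubleton_eq_iff vertex_inj)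
    then show ?thesis using Suc_mod_6_asym that(2,3) by blast
  qed
  show ?thesis
  proof (rule inj_onI)
    fix p q
    assume pq: "p \<in> {1..n} \<times> {..<6}" "q \<in> {1..n} \<times> {..<6}" "hex_edge p = hex_edge q"
    obtain i a j b where ia: "p = (i, a)" "q = (j, b)" by (meson surj_pair)
    with pq have h: "hex_edge (i, a) = hex_edge (j, b)" "a < 6" "b < 6" by auto
    have "\<not> i < j" "\<not> j < i"
      using no[OF h(1)] no[OF h(1)[symmetric]] h(2,3) by auto
    then have "i = j" by simp
    with same[of i a b] h ia show "p = q" by simp
  qed
qed

lemma edge_sum_chain:
  assumes sym: "\<And>u v. f u v = f v u"
  shows "edge_sum chain f = (\<Sum>i=1..n. \<Sum>a<6. f (vertex i a) (vertex i (Suc a mod 6)))"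
proof -
  have "(THE r. \<exists>u v. {p, q} = {u, v} \<and> r = f u v) = f p q" for p q
    by (rule the_equality) (use sym in \<open>auto simp: doubleton_eq_iff\<close>)
  then have "edge_sum chain f =
      (\<Sum>(i, a)\<in>{1..n} \<times> {..<6}. f (vertex i a) (vertex i (Suc a mod 6)))"
    unfolding edge_sum_def edges_chain sum.reindex[OF hex_edge_inj]
    by (intro sum.cong) (auto simp: hex_edge_def)
  then show ?thesis by (simp add: sum.cartesian_product)
qed

text \<open>Connectedness makes all distances finite; between infinite distances no strict comparison
  could hold.\<close>

lemma chain_connected:
  assumes "u \<in> verts chain" "v \<in> verts chain"
  shows "(u, v) \<in> (adj_rel chain)\<^sup>*"
proof -
  let ?R = "(adj_rel chain)\<^sup>*"
  have sym: "(s, t) \<in> ?R" if "(t, s) \<in> ?R" for s t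
  proof -
    have "sym (adj_rel chain)" by (auto simp: sym_def adj_rel_def insert_commute)
    then show ?thesis using that by (meson sym_rtrancl symD)
  qed
  have root: "(vertex i 0, vertex i a) \<in> ?R" if "i \<in> {1..n}" "a < 6" for i a
    using that(2)
  proof (induction a)
    case (Suc a)
    then have "{a, Suc a} \<in> edges hexagon" by (simp add: hexagon_edge)
    then have "(vertex i a, vertex i (Suc a)) \<in> adj_rel chain"
      using edge_in_chain that(1) by (simp add: adj_rel_def)
    then show ?case using Suc by (meson Suc_lessD rtrancl.rtrancl_into_rtrancl)
  qed simp
  have base: "(vertex 1 0, vertex i 0) \<in> ?R" if "1 \<le> i" "i \<le> n" for i
    using that
  proof (induction i rule: dec_induct)
    case (step i)
    then have "(vertex i 0, vertex i (y i)) \<in> ?R"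
      using root[of i "y i"] contact_less(2)[of i] by auto
    moreover have "vertex i (y i) = vertex (Suc i) (x (Suc i))"
      using contact_vertex[of i] step.hyps step.prems by simp
    moreover have "(vertex (Suc i) (x (Suc i)), vertex (Suc i) 0) \<in> ?R"
      by (rule sym, intro root contact_less(1)) (use step.prems in simp)+
    moreover have "(vertex 1 0, vertex i 0) \<in> ?R"
      using step.IH step.prems by simp
    ultimately show ?case by (metis rtrancl_trans)
  qed simp
  have "(vertex 1 0, w) \<in> ?R" if "w \<in> verts chain" for w
  proof -
    obtain i a where i: "i \<in> {1..n}" "a < 6" "w = vertex i a"
      using \<open>w \<in> verts chain\<close> unfolding verts_chain by blast
    then have "(vertex 1 0, vertex i 0) \<in> ?R" by (intro base) auto
    also have "(vertex i 0, w) \<in> ?R" using root i by blast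
    finally show ?thesis .
  qed
  then show ?thesis using assms sym by (meson rtrancl_trans)
qed

section \<open>The sides of a cut\<close>

text \<open>The earlier hexagons lie on the same side of a cut of hexagon \<open>i\<close> as \<open>x i\<close>, the later ones on the
  same side as \<open>y i\<close>.\<close>

definition on_side :: "nat \<Rightarrow> nat set \<Rightarrow> nat \<times> nat \<Rightarrow> bool" where
  "on_side i H = (\<lambda>(j, b). (if j < i then x i else if j = i then b else y i) \<in> H)"

definition side :: "nat \<Rightarrow> nat set \<Rightarrow> (nat \<times> nat) set set" where
  "side i H = {glue_class n x y p | p. on_side i H p}"

lemma vertex_in_side: "vertex j b \<in> side i H \<longleftrightarrow> on_side i H (j, b)"
proof -
  have "on_side i H p = on_side i H q" if "glue_class n x y p = glue_class n x y q" for p q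
    by (rule same_class_invariant[OF _ that]) (auto simp: on_side_def less_Suc_eq)
  then show ?thesis unfolding side_def by blast
qed

text \<open>One pair from each class: of the two names of a contact vertex, the one in the hexagon nearer to
  hexagon \<open>i\<close> is kept. So hexagon \<open>i\<close> contributes six vertices and every other hexagon five.\<close>

definition representatives :: "nat \<Rightarrow> (nat \<times> nat) set" where
  "representatives i =
     (SIGMA j:{1..<i}. {..<6} - {y j}) \<union> {i} \<times> {..<6} \<union> (SIGMA j:{i<..n}. {..<6} - {x j})"

lemma representatives_bij:
  assumes "i \<in> {1..n}"
  shows "bij_betw (glue_class n x y) (representatives i) (verts chain)"
proof -
  have i_bounds: "1 \<le> i" "i \<le> n" using assms by auto
  have later: False
    if "(j, b) \<in> representatives i" "(l, d) \<in> representatives i"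
      "vertex j b = vertex l d" "j < l" for j b l d
    using same_vertex_later[OF that(3,4)] that(1,2) assms by (auto simp: representatives_def)
  have inj: "inj_on (glue_class n x y) (representatives i)"
  proof (rule inj_onI)
    fix p q
    assume pq: "p \<in> representatives i" "q \<in> representatives i"
      "glue_class n x y p = glue_class n x y q"
    obtain j b l d where jb: "p = (j, b)" "q = (l, d)" by (meson surj_pair)
    with pq have h: "(j, b) \<in> representatives i" "(l, d) \<in> representatives i"
      "vertex j b = vertex l d" by auto
    have "\<not> j < l" "\<not> l < j" using later[OF h] later[OF h(2,1) h(3)[symmetric]] by auto
    then have "j = l" by simp
    then show "p = q" using h(3) jb by (simp add: vertex_inj)
  qed
  have "vertex j b \<in> glue_class n x y ` representatives i"
    if j: "j \<in> {1..n}" "b < 6" for j b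
  proof (cases "(j, b) \<in> representatives i")
    case False
    then have "j < i \<and> b = y j \<or> i < j \<and> b = x j"
      using j i_bounds
      by (cases i j rule: linorder_cases) (auto simp: representatives_def)
    then consider "j < i" "b = y j" | "i < j" "b = x j" by blast
    then show ?thesis
    proof cases
      case 1
      then have "(Suc j, x (Suc j)) \<in> representatives i"
        using contact_neq[of "Suc j"] contact_less[of "Suc j"] j assms
        by (auto simp: representatives_def)
      moreover have "vertex j b = vertex (Suc j) (x (Suc j))"
        using 1 j i_bounds contact_vertex[of j] by simp
      ultimately show ?thesis by blast
    next
      case 2
      then obtain l where l: "j = Suc l" by (cases j) auto
      then have "(l, y l) \<in> representatives i"
        using contact_neq[of l] contact_less[of l] j assms 2
        by (auto simp: representatives_def)
      moreover have "vertex j b = vertex l (y l)"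
        using 2 j i_bounds contact_vertex[of l] l by simp
      ultimately show ?thesis by blast
    qed
  qed (rule imageI)
  then have "verts chain \<subseteq> glue_class n x y ` representatives i"
    unfolding verts_chain by blast
  moreover have "glue_class n x y (j, b) \<in> verts chain" if "(j, b) \<in> representatives i" for j b
    by (rule vertex_in_chain) (use that i_bounds in \<open>auto simp: representatives_def\<close>)
  then have "glue_class n x y ` representatives i \<subseteq> verts chain" by auto
  ultimately show ?thesis
    using inj unfolding bij_betw_def by blast
qed

definition side_size :: "nat \<Rightarrow> nat set \<Rightarrow> nat" where
  "side_size i H =
     3 + (if x i \<in> H then 5 * (i - 1) else 0) + (if y i \<in> H then 5 * (n - i) else 0)"

lemma card_side:
  assumes i: "i \<in> {1..n}" and a: "a < 6"
  shows "card (verts chain \<inter> side i (half a)) = side_size i (half a)"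
proof -
  let ?H = "half a"
  let ?L = "if x i \<in> ?H then SIGMA j:{1..<i}. {..<6} - {y j} else {}"
  let ?R = "if y i \<in> ?H then SIGMA j:{i<..n}. {..<6} - {x j} else {}"
  let ?C = "{i} \<times> {b. b < 6 \<and> b \<in> ?H}"
  have "verts chain \<inter> side i ?H =
      glue_class n x y ` {p \<in> representatives i. on_side i ?H p}"
  proof -
    have "glue_class n x y p \<in> side i ?H \<longleftrightarrow> on_side i ?H p" for p
      using vertex_in_side by (cases p) auto
    then show ?thesis
      unfolding bij_betw_imp_surj_on[OF representatives_bij[OF i], symmetric] by auto
  qed
  then have "card (verts chain \<inter> side i ?H) = card {p \<in> representatives i. on_side i ?H p}"
    using representatives_bij[OF i]
    by (metis (no_types, lifting) bij_betw_imp_inj_on card_image inj_on_subset mem_Collect_eq subsetI)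
  also have "{p \<in> representatives i. on_side i ?H p} = ?L \<union> ?C \<union> ?R"
    by (auto simp: representatives_def on_side_def)
  also have "card (?L \<union> ?C \<union> ?R) = card ?L + card ?C + card ?R"
    by (subst card_Un_disjoint, (auto)[3], subst card_Un_disjoint) auto
  also have "card ?C = 3" by (simp only: card_cartesian_product card_half[OF a]) simp
  also have "card ?L = (if x i \<in> ?H then 5 * (i - 1) else 0)"
    using contact_less(2) i by (auto simp: card_SigmaI card_Diff_singleton)
  also have "card ?R = (if y i \<in> ?H then 5 * (n - i) else 0)"
    using contact_less(1) i by (auto simp: card_SigmaI card_Diff_singleton)
  finally show ?thesis by (simp add: side_size_def)
qed

text \<open>Hexagon \<open>i\<close> is folded onto \<open>half a\<close>. The part of the chain attached at a contact vertex \<open>z\<close> of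
  hexagon \<open>i\<close> stays in place if \<open>z\<close> is in \<open>half a\<close>, and otherwise is collapsed to the mirror image of
  \<open>z\<close>. In both cases \<open>z\<close> itself is treated alike from its two hexagons, so that the map
  is well defined on the glued graph.\<close>

lemma side_fold:
  assumes i: "i \<in> {1..n}" and a: "a < 6"
  obtains \<phi> where "folds_onto chain (side i (half a)) \<phi>"
    "\<And>b. \<phi> (vertex i b) = vertex i (fold_hex a b)"
proof -
  define F where "F = (\<lambda>(j, b).
    if j = i then vertex i (fold_hex a b)
    else let z = (if j < i then x i else y i)
         in if z \<in> half a then vertex j b else vertex i (fold_hex a z))"
  have "F (j, y j) = F (Suc j, x (Suc j))" if "1 \<le> j" "j < n" for j
    using contact_vertex[OF that] by (auto simp: F_def fold_hex_def Let_def less_Suc_eq)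
  then obtain \<phi> where \<phi>: "\<And>p. \<phi> (glue_class n x y p) = F p"
    using descends by metis
  have id: "\<phi> w = w" if "w \<in> side i (half a)" for w
    using that by (auto simp: side_def \<phi> F_def on_side_def fold_hex_def split: if_splits)
  have edge: "F (j, b) = F (j, Suc b mod 6) \<or> {F (j, b), F (j, Suc b mod 6)} \<in> edges chain \<and>
      (on_side i (half a) (j, b) \<longleftrightarrow> on_side i (half a) (j, Suc b mod 6))"
    if j: "j \<in> {1..n}" "b < 6" for j b
  proof (cases "j = i")
    case True
    then show ?thesis using fold_hex_edge[OF a j(2)] edge_in_chain[OF i]
      by (auto simp: F_def on_side_def)
  next
    case False
    have "{vertex j b, vertex j (Suc b mod 6)} \<in> edges chain"
      using j by (intro edge_in_chain) (auto simp: hexagon_edge)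
    then show ?thesis using False by (auto simp: F_def on_side_def Let_def)
  qed
  have "\<phi> s = \<phi> t \<or> {\<phi> s, \<phi> t} \<in> edges chain \<and>
      (s \<in> side i (half a) \<longleftrightarrow> t \<in> side i (half a))"
    if "{s, t} \<in> edges chain" for s t
    using that
  proof (rule edge_chain_cases)
    fix j b assume "j \<in> {1..n}" "b < 6"
      "s = vertex j b \<and> t = vertex j (Suc b mod 6) \<or> t = vertex j b \<and> s = vertex j (Suc b mod 6)"
    then show ?thesis using edge[of j b] by (auto simp: \<phi> vertex_in_side insert_commute)
  qed
  with id have "folds_onto chain (side i (half a)) \<phi>"
    unfolding folds_onto_def by blast
  moreover have "\<phi> (vertex i b) = vertex i (fold_hex a b)" for b by (simp add: \<phi> F_def)
  ultimately show ?thesis using that by blast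
qed

text \<open>The edge from \<open>a\<close> to \<open>a + 1\<close> belongs to the cut with halves \<open>half a\<close> and \<open>half (a + 3)\<close>, and
  the fold onto each half carries one end of the edge to the other.\<close>

lemma n_closer_edge:
  assumes i: "i \<in> {1..n}" and a: "a < 6"
  shows "n_closer chain (vertex i (Suc a mod 6)) (vertex i a) = side_size i (half a)"
    and "n_closer chain (vertex i a) (vertex i (Suc a mod 6)) = side_size i (half ((a + 3) mod 6))"
proof -
  let ?H = "half a" and ?K = "half ((a + 3) mod 6)"
  let ?u = "vertex i (Suc a mod 6)" and ?v = "vertex i a"
  obtain \<phi> where \<phi>: "folds_onto chain (side i ?H) \<phi>" "\<phi> ?v = ?u"
    using side_fold[OF i a] endpoints_half(3)[OF a] by metis
  have "(a + 3) mod 6 < 6" by simp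
  then obtain \<psi> where \<psi>: "folds_onto chain (side i ?K) \<psi>" "\<psi> ?u = ?v"
    using side_fold[OF i] endpoints_half(4)[OF a] by metis
  have compl: "w \<in> side i ?K \<longleftrightarrow> w \<notin> side i ?H" if "w \<in> verts chain" for w
    using that i half_opposite[OF a] contact_less
    by (auto simp: verts_chain vertex_in_side on_side_def)
  have verts: "?u \<in> verts chain" "?v \<in> verts chain"
    using i a by (auto intro: vertex_in_chain)
  have u: "?u \<in> side i ?H"
    using endpoints_half(1)[OF a] by (simp add: vertex_in_side on_side_def)
  have "?v \<notin> side i ?H"
    using endpoints_half(2)[OF a] by (simp add: vertex_in_side on_side_def)
  then have v: "?v \<in> side i ?K" using compl verts by blast
  have "n_closer chain ?u ?v = card (verts chain \<inter> side i ?H)"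
    using n_closer_fold[OF chain_connected \<phi>(1) u verts(1) \<phi>(2) \<psi>(1) v verts(2) \<psi>(2)] compl
    by blast
  then show "n_closer chain ?u ?v = side_size i ?H" by (simp add: card_side[OF i a])
  have "n_closer chain ?v ?u = card (verts chain \<inter> side i ?K)"
    using n_closer_fold[OF chain_connected \<psi>(1) v verts(2) \<psi>(2) \<phi>(1) u verts(1) \<phi>(2)] compl
    by blast
  then show "n_closer chain ?v ?u = side_size i ?K" by (simp add: card_side[OF i])
qed

lemma hexagon_side_sum:
  fixes g :: "nat \<Rightarrow> nat \<Rightarrow> real"
  assumes i: "i \<in> {1..n}" and sym: "\<And>p q. g p q = g q p"
  shows "(\<Sum>a<6. g (side_size i (half ((a + 3) mod 6))) (side_size i (half a))) =
    4 * g (5 * i - 2) (5 * n - 5 * i + 3) + 2 * g 3 (5 * n - 2)"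
proof -
  define l r where "l = 5 * (i - 1)" and "r = 5 * (n - i)"
  have size: "5 * i - 2 = 3 + l" "5 * n - 5 * i + 3 = 3 + r" "5 * n - 2 = 3 + l + r"
    using i by (auto simp: l_def r_def)
  let ?s = "\<lambda>p q. 3 + (if p then l else 0) + (if q then r else 0)"
  let ?f = "\<lambda>p q. g (?s (\<not> p) (\<not> q)) (?s p q)"
  have "(\<Sum>a<6. g (side_size i (half ((a + 3) mod 6))) (side_size i (half a))) =
      (\<Sum>a<6. ?f (x i \<in> half a) (y i \<in> half a))"
    using contact_less[OF i]
    by (intro sum.cong refl) (simp add: side_size_def half_opposite l_def r_def)
  also have "\<dots> = 2 * ?f True False + 2 * ?f False True + ?f True True + ?f False False"
    using contact[OF i] by (intro sum_cut_patterns) auto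
  also have "\<dots> = 4 * g (3 + l) (3 + r) + 2 * g 3 (3 + l + r)"
    by (simp add: sym)
  finally show ?thesis by (simp only: size)
qed

section \<open>Degrees\<close>

text \<open>The class of such a vertex is a singleton, so all its edges lie in hexagon \<open>i\<close>.\<close>

lemma degree_noncontact:
  assumes i: "i \<in> {1..n}" and b: "b < 6" "b \<noteq> x i" "b \<noteq> y i"
  shows "degree chain (vertex i b) = 2"
proof -
  have same: "j = i \<and> d = b" if "vertex i b = vertex j d" for j d
  proof -
    have "j = i"
      using same_vertex_later[OF that] same_vertex_later[OF that[symmetric]] b(2,3)
      by (metis linorder_neqE_nat)
    then show ?thesis using that vertex_inj by auto
  qed
  have "{v \<in> verts chain. {vertex i b, v} \<in> edges chain} =
      {vertex i (Suc b mod 6), vertex i ((b + 5) mod 6)}" (is "?N = ?M")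
  proof
    show "?N \<subseteq> ?M"
    proof
      fix v assume "v \<in> ?N"
      then have "{vertex i b, v} \<in> edges chain" by simp
      then show "v \<in> ?M"
      proof (rule edge_chain_cases)
        fix j a assume a: "a < 6"
          "vertex i b = vertex j a \<and> v = vertex j (Suc a mod 6) \<or>
           v = vertex j a \<and> vertex i b = vertex j (Suc a mod 6)"
        then consider "j = i" "a = b" "v = vertex i (Suc b mod 6)"
          | "j = i" "Suc a mod 6 = b" "v = vertex i a"
          using same by metis
        then show ?thesis
        proof cases
          case 2
          then have "a = (b + 5) mod 6" using Suc_mod_6_iff[OF a(1) b(1)] by simp
          then show ?thesis using 2 by simp
        qed simp
      qed
    qed
  next
    have "{b, Suc b mod 6} \<in> edges hexagon" "{b, (b + 5) mod 6} \<in> edges hexagon"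
      using b(1) unfolding less_6_cases by (elim disjE; simp add: hexagon_edge)+
    then show "?M \<subseteq> ?N"
      using edge_in_chain[OF i] vertex_in_chain[OF i] by auto
  qed
  moreover have "Suc b mod 6 \<noteq> (b + 5) mod 6"
    using b(1) unfolding less_6_cases by (elim disjE; simp)
  ultimately show ?thesis by (simp add: degree_def vertex_inj)
qed

lemma degree_pos:
  assumes "{u, v} \<in> edges chain" "v \<in> verts chain"
  shows "degree chain u > 0"
  using assms finite_verts by (auto simp: degree_def card_gt_0_iff)

text \<open>Contact vertices have distance 2, so an edge has an end that is not one, and that end has
  degree 2.\<close>

lemma ABC_term:
  assumes i: "i \<in> {1..n}" and a: "a < 6"
  defines "d \<equiv> real (degree chain (vertex i a))"
    and "e \<equiv> real (degree chain (vertex i (Suc a mod 6)))"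
  shows "sqrt ((d + e - 2) / (d * e)) = sqrt 2 / 2"
proof -
  have edge: "{vertex i a, vertex i (Suc a mod 6)} \<in> edges chain"
    using i a by (intro edge_in_chain) (auto simp: hexagon_edge)
  have pos: "d > 0" "e > 0"
    using degree_pos[OF edge] degree_pos[of "vertex i (Suc a mod 6)" "vertex i a"] edge i a
    by (auto simp: d_def e_def insert_commute vertex_in_chain)
  have "a \<noteq> x i \<and> a \<noteq> y i \<or> Suc a mod 6 \<noteq> x i \<and> Suc a mod 6 \<noteq> y i"
    using contact[OF i] a unfolding less_6_cases by (elim conjE disjE; simp)
  then have "d = 2 \<or> e = 2"
    using degree_noncontact[OF i] a by (auto simp: d_def e_def)
  then have "(d + e - 2) / (d * e) = 1 / 2"
    using pos by (auto simp: field_simps)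
  moreover have "sqrt (1 / 2) = sqrt 2 / 2"
    by (simp add: real_sqrt_divide field_simps)
  ultimately show ?thesis by (simp only:)
qed

section \<open>Evaluation of the two indices\<close>

lemma ABC_chain: "ABC chain = 3 * real n * sqrt 2"
proof -
  have "ABC chain = (\<Sum>i=1..n. \<Sum>a<(6::nat). sqrt 2 / 2)"
    unfolding ABC_def
    by (subst edge_sum_chain, simp only: add.commute mult.commute)
       (intro sum.cong refl ABC_term, auto)
  then show ?thesis by simp
qed

lemma ABC_GG_chain:
  "ABC_GG chain =
     4 * (\<Sum>i=1..n. sqrt ((5 * real n - 1) / ((5 * real n - 5 * real i + 3) * (5 * real i - 2)))) +
     2 * real n * sqrt ((5 * real n - 1) / (15 * real n - 6))"
proof -
  define g :: "nat \<Rightarrow> nat \<Rightarrow> real"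
    where "g p q = sqrt ((real p + real q - 2) / (real p * real q))" for p q
  have sym: "g p q = g q p" for p q by (simp add: g_def add.commute mult.commute)
  have "ABC_GG chain = edge_sum chain (\<lambda>u v. g (n_closer chain u v) (n_closer chain v u))"
    by (simp add: ABC_GG_def g_def)
  also have "\<dots> = (\<Sum>i=1..n. \<Sum>a<6.
      g (side_size i (half ((a + 3) mod 6))) (side_size i (half a)))"
    by (subst edge_sum_chain[OF sym]) (simp add: n_closer_edge)
  also have "\<dots> = (\<Sum>i=1..n. 4 * g (5 * i - 2) (5 * n - 5 * i + 3) + 2 * g 3 (5 * n - 2))"
    by (intro sum.cong refl hexagon_side_sum sym)
  also have "\<dots> = (\<Sum>i=1..n.
      4 * sqrt ((5 * real n - 1) / ((5 * real n - 5 * real i + 3) * (5 * real i - 2))) +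
      2 * sqrt ((5 * real n - 1) / (15 * real n - 6)))"
  proof (intro sum.cong refl)
    fix i assume "i \<in> {1..n}"
    then have of_nat: "real (5 * i - 2) = 5 * real i - 2" "real (5 * n - 2) = 5 * real n - 2"
      "real (5 * n - 5 * i + 3) = 5 * real n - 5 * real i + 3"
      by (auto simp: of_nat_diff)
    have "g (5 * i - 2) (5 * n - 5 * i + 3) =
        sqrt ((5 * real n - 1) / ((5 * real n - 5 * real i + 3) * (5 * real i - 2)))"
      unfolding g_def of_nat by (simp add: mult.commute)
    moreover have "g 3 (5 * n - 2) = sqrt ((5 * real n - 1) / (15 * real n - 6))"
      unfolding g_def of_nat by (simp add: algebra_simps)
    ultimately show "4 * g (5 * i - 2) (5 * n - 5 * i + 3) + 2 * g 3 (5 * n - 2) =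
      4 * sqrt ((5 * real n - 1) / ((5 * real n - 5 * real i + 3) * (5 * real i - 2))) +
      2 * sqrt ((5 * real n - 1) / (15 * real n - 6))"
      by simp
  qed
  finally show ?thesis by (simp add: sum.distrib sum_distrib_left)
qed

end

lemma meta_chain_realisation:
  assumes "is_meta_chain n M"
  obtains x y where "meta_chain n x y" "M = hexagon_chain n x y"
proof -
  have verts: "a \<in> verts hexagon \<longleftrightarrow> a < 6" for a by (simp add: hexagon_def)
  obtain x y where xy: "\<And>i. i \<in> {1..n} \<Longrightarrow> x i < 6 \<and> y i < 6 \<and> gdist hexagon (x i) (y i) = 2"
    and M: "M = hexagon_chain n x y"
    using assms unfolding is_meta_chain_def verts by blast
  have "meta_chain n x y"
    by unfold_locales (use xy distance_two_hexagon in blast)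
  then show ?thesis using M that by blast
qed

lemma sum_symmetric:
  fixes h :: "nat \<Rightarrow> real"
  assumes "\<And>i. i \<in> {1..k} \<Longrightarrow> h (Suc n - i) = h i" "2 * k \<le> n"
  shows "(\<Sum>i=1..n. h i) = 2 * (\<Sum>i=1..k. h i) + (\<Sum>i=Suc k..n - k. h i)"
proof -
  have mirror: "h (Suc n - i) = h i" if "Suc (n - k) \<le> i" "i \<le> n" for i
  proof -
    have "Suc n - i \<in> {1..k}" unfolding atLeastAtMost_iff using assms(2) that by linarith
    then show ?thesis using assms(1)[of "Suc n - i"] that by simp
  qed
  have "(\<Sum>i=Suc (n - k)..n. h i) = (\<Sum>i=1..k. h i)"
    by (rule sum.reindex_bij_witness[of _ "\<lambda>i. Suc n - i" "\<lambda>i. Suc n - i"])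
       (use assms mirror in auto)
  moreover have "(\<Sum>i=1..n. h i) =
      (\<Sum>i=1..k. h i) + (\<Sum>i=Suc k..n - k. h i) + (\<Sum>i=Suc (n - k)..n. h i)"
    using assms(2) sum.ub_add_nat[of 1 k h "n - k - k"] sum.ub_add_nat[of 1 "n - k" h k] by simp
  ultimately show ?thesis by simp
qed

theorem theorem3p8:
  fixes n :: nat and M :: "(nat \<times> nat) set graph"
  assumes "n \<ge> 2" and "is_meta_chain n M"
  shows "(\<forall>k::nat. k \<ge> 1 \<longrightarrow>
           (n = 2 * k \<longrightarrow>
              ABC_GG M =
                8 * (\<Sum>i=1..k. sqrt ((10 * real k - 1) /
                       ((10 * real k - 5 * real i + 3) * (5 * real i - 2))))
                + 4 * real k * sqrt ((10 * real k - 1) / (30 * real k - 6))) \<and>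
           (n = 2 * k + 1 \<longrightarrow>
              ABC_GG M =
                8 * (\<Sum>i=1..k. sqrt ((10 * real k + 4) /
                       ((10 * real k - 5 * real i + 8) * (5 * real i - 2))))
                + (4 * real k + 2) * sqrt ((10 * real k + 4) / (30 * real k + 9))
                + 4 * sqrt (10 * real k + 4) / (5 * real k + 3))) \<and>
         ABC M = 3 * real n * sqrt 2"
proof -
  obtain x y where chain: "meta_chain n x y" "M = hexagon_chain n x y"
    using meta_chain_realisation[OF assms(2)] by blast
  define h where
    "h i = sqrt ((5 * real n - 1) / ((5 * real n - 5 * real i + 3) * (5 * real i - 2)))" for i
  have GG: "ABC_GG M =
      4 * (\<Sum>i=1..n. h i) + 2 * real n * sqrt ((5 * real n - 1) / (15 * real n - 6))"
    unfolding chain(2) h_def by (rule meta_chain.ABC_GG_chain[OF chain(1)])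
  have sym: "h (Suc n - i) = h i" if "i \<le> n" for i
    using that by (simp add: h_def of_nat_diff algebra_simps)
  have even: "ABC_GG M =
      8 * (\<Sum>i=1..k. sqrt ((10 * real k - 1) / ((10 * real k - 5 * real i + 3) * (5 * real i - 2))))
      + 4 * real k * sqrt ((10 * real k - 1) / (30 * real k - 6))" if "n = 2 * k" for k
  proof -
    have "(\<Sum>i=1..n. h i) = 2 * (\<Sum>i=1..k. h i)"
      using sum_symmetric[of k h n] sym that by simp
    then show ?thesis by (simp add: GG h_def that)
  qed
  have odd: "ABC_GG M =
      8 * (\<Sum>i=1..k. sqrt ((10 * real k + 4) / ((10 * real k - 5 * real i + 8) * (5 * real i - 2))))
      + (4 * real k + 2) * sqrt ((10 * real k + 4) / (30 * real k + 9))
      + 4 * sqrt (10 * real k + 4) / (5 * real k + 3)" if "n = 2 * k + 1" for k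
  proof -
    have "(\<Sum>i=1..n. h i) = 2 * (\<Sum>i=1..k. h i) + h (Suc k)"
      using sum_symmetric[of k h n] sym that by simp
    moreover have "h (Suc k) = sqrt (10 * real k + 4) / (5 * real k + 3)"
    proof -
      have "h (Suc k) = sqrt ((10 * real k + 4) / (5 * real k + 3)\<^sup>2)"
        by (simp add: h_def that power2_eq_square algebra_simps)
      then show ?thesis by (simp add: real_sqrt_divide)
    qed
    moreover have "h i = sqrt ((10 * real k + 4) /
        ((10 * real k - 5 * real i + 8) * (5 * real i - 2)))" for i
      by (simp add: h_def that algebra_simps)
    ultimately show ?thesis by (simp add: GG that algebra_simps)
  qed
  have "ABC M = 3 * real n * sqrt 2"
    unfolding chain(2) by (rule meta_chain.ABC_chain[OF chain(1)])
  with even odd show ?thesis by blast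
qed

end
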